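(* Consider the three-firm (triopoly) sequential quantity game described in the context, and assume: each $X_i$ is a closed nonempty subset of $\mathbb R$; there is a nonempty closed set $D\subseteq X_1\times X_2\times X_3$ with $\mathcal G_1(D)\subseteq D$; and there is $\alpha\in(0,1)$ with $M_1(\mathcal G_1(\overline{x}),\mathcal G_1(\overline{u}))\le\alpha M_1(\overline{x},\overline{u})$ for all $\overline{x},\overline{u}\in D$. Let $(x^*,y^*,z^* )$ be the unique stationary Stackelberg triple in $D$. Assume that it is an interior point of $D$, that the functions involved are twice continuously differentiable in a neighborhood of this point, and that $\mathcal T_1(D)\subseteq D$. If there exists $\beta\in(0,1)$ such that $$M_1(\mathcal T_1(\overline{x}),\mathcal T_1(\overline{u}))\le\beta M_1(\overline{x},\overline{u})\qquad\text{for all }\overline{x},\overline{u}\in D,$$ then $$\frac{\partial^2\Pi_3}{\partial z^2}(x^*,y^*,z^* )<0,\qquad \frac{\partial^2\Phi_2}{\partial y^2}(x^*,y^* )<0,\qquad \frac{d^2\Phi_1}{dx^2}(x^* )<0.$$ Consequently, $(x^*,y^*,z^* )$ satisfies the second-order sufficient conditions for strict local maximization for all three firms.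
   Context: Market. Three firms choose outputs $x\in X_1$, $y\in X_2$, $z\in X_3$, $X_i\subseteq\mathbb R$. With inverse demand function $P$ and cost functions $c_1,c_2,c_3$ (real-valued functions of a real variable), the payoffs are $\Pi_1(x,y,z)=xP(x+y+z)-c_1(x)$, $\Pi_2(x,y,z)=yP(x+y+z)-c_2(y)$, $\Pi_3(x,y,z)=zP(x+y+z)-c_3(z)$. All derivatives appearing below are assumed to exist; each is taken with respect to a variable ranging over the corresponding set $X_i$. Derivative-generated maps and stationary responses (defined recursively), together with the standing assumptions. - $F_3(x,y,z)=z+\frac{\partial\Pi_3}{\partial z}(x,y,z)$; it is assumed that for every $(x,y)\in X_1\times X_2$ the equation $F_3(x,y,z)=z$ has a unique solution $z=b_3(x,y)\in X_3$. - $\Phi_2(x,y)=\Pi_2(x,y,b_3(x,y))$ and $F_2(x,y,z)=y+\frac{\partial\Phi_2}{\partial y}(x,y)$ (independent of $z$); it is assumed that for every $x\in X_1$ the equation $F_2(x,y,b_3(x,y))=y$ has a unique solution $y=b_2(x)\in X_2$. - $\Phi_1(x)=\Pi_1(x,b_2(x),b_3(x,b_2(x)))$ and $F_1(x,y,z)=x+\frac{d\Phi_1}{dx}(x)$ (independent of $y,z$), assumed to take values in $X_1$. Maps. For $(x,y,z)\in X_1\times X_2\times X_3$: $\mathcal G_1(x,y,z)=\bigl(F_1(x,b_2(x),b_3(x,b_2(x))),\,b_2(x),\,b_3(x,b_2(x))\bigr)$, $\mathcal T_1(x,y,z)=\bigl(F_1(x,b_2(x),b_3(x,b_2(x))),\,F_2(x,y,b_3(x,y)),\,F_3(x,y,z)\bigr)$.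 Stationary Stackelberg triple. $(x^*,y^*,z^* )\in X_1\times X_2\times X_3$ such that $\frac{d\Phi_1}{dx}(x^* )=0$, $\frac{\partial\Phi_2}{\partial y}(x^*,y^* )=0$, $\frac{\partial\Pi_3}{\partial z}(x^*,y^*,z^* )=0$, and $y^*=b_2(x^* )$, $z^*=b_3(x^*,y^* )$. Under the stated closedness, invariance and $\alpha$-contraction hypotheses on $\mathcal G_1$ there is exactly one such triple in $D$. Metric. $M_1((x,y,z),(u,v,w))=|x-u|+|y-v|+|z-w|$. "Interior point" is with respect to $\mathbb R^3$. "The functions involved" are $\Pi_3$, $\Phi_2$, $\Phi_1$ and the functions they are built from. The second-order sufficient conditions for strict local maximization are: the first derivatives $\frac{\partial\Pi_3}{\partial z}(x^*,y^*,z^* )$, $\frac{\partial\Phi_2}{\partial y}(x^*,y^* )$, $\frac{d\Phi_1}{dx}(x^* )$ vanish and the corresponding second derivatives are strictly negative. *)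

theory Defs
  imports "HOL-Analysis.Analysis"
begin

record triopoly =
  X\<^sub>1 :: "real set"
  X\<^sub>2 :: "real set"
  X\<^sub>3 :: "real set"
  demand :: "real \<Rightarrow> real"
  c\<^sub>1 :: "real \<Rightarrow> real"
  c\<^sub>2 :: "real \<Rightarrow> real"
  c\<^sub>3 :: "real \<Rightarrow> real"

text \<open>
  Derivative with respect to a variable ranging over \<open>X\<close> (one-sided at endpoints of intervals).
  The value is meaningful only if the derivative exists and the point is not isolated in \<open>X\<close>;
  at an isolated point of \<open>X\<close> it is an unspecified real.
\<close>

definition deriv_on :: "real set \<Rightarrow> (real \<Rightarrow> real) \<Rightarrow> real \<Rightarrow> real" where
  "deriv_on X f x = vector_derivative f (at x within X)"

definition \<Pi>\<^sub>1 :: "triopoly \<Rightarrow> real \<Rightarrow> real \<Rightarrow> real \<Rightarrow> real" where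
  "\<Pi>\<^sub>1 M x y z = x * demand M (x + y + z) - c\<^sub>1 M x"

definition \<Pi>\<^sub>2 :: "triopoly \<Rightarrow> real \<Rightarrow> real \<Rightarrow> real \<Rightarrow> real" where
  "\<Pi>\<^sub>2 M x y z = y * demand M (x + y + z) - c\<^sub>2 M y"

definition \<Pi>\<^sub>3 :: "triopoly \<Rightarrow> real \<Rightarrow> real \<Rightarrow> real \<Rightarrow> real" where
  "\<Pi>\<^sub>3 M x y z = z * demand M (x + y + z) - c\<^sub>3 M z"

definition F\<^sub>3 :: "triopoly \<Rightarrow> real \<Rightarrow> real \<Rightarrow> real \<Rightarrow> real" where
  "F\<^sub>3 M x y z = z + deriv_on (X\<^sub>3 M) (\<lambda>t. \<Pi>\<^sub>3 M x y t) z"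

definition b\<^sub>3 :: "triopoly \<Rightarrow> real \<Rightarrow> real \<Rightarrow> real" where
  "b\<^sub>3 M x y = (THE z. z \<in> X\<^sub>3 M \<and> F\<^sub>3 M x y z = z)"

definition \<Phi>\<^sub>2 :: "triopoly \<Rightarrow> real \<Rightarrow> real \<Rightarrow> real" where
  "\<Phi>\<^sub>2 M x y = \<Pi>\<^sub>2 M x y (b\<^sub>3 M x y)"

definition F\<^sub>2 :: "triopoly \<Rightarrow> real \<Rightarrow> real \<Rightarrow> real \<Rightarrow> real" where
  "F\<^sub>2 M x y z = y + deriv_on (X\<^sub>2 M) (\<lambda>t. \<Phi>\<^sub>2 M x t) y"

definition b\<^sub>2 :: "triopoly \<Rightarrow> real \<Rightarrow> real" where
  "b\<^sub>2 M x = (THE y. y \<in> X\<^sub>2 M \<and> F\<^sub>2 M x y (b\<^sub>3 M x y) = y)"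

definition \<Phi>\<^sub>1 :: "triopoly \<Rightarrow> real \<Rightarrow> real" where
  "\<Phi>\<^sub>1 M x = \<Pi>\<^sub>1 M x (b\<^sub>2 M x) (b\<^sub>3 M x (b\<^sub>2 M x))"

definition F\<^sub>1 :: "triopoly \<Rightarrow> real \<Rightarrow> real \<Rightarrow> real \<Rightarrow> real" where
  "F\<^sub>1 M x y z = x + deriv_on (X\<^sub>1 M) (\<Phi>\<^sub>1 M) x"

text \<open>
  The definite descriptions \<open>b\<^sub>3\<close> and \<open>b\<^sub>2\<close> above are meaningful only under the two unique
  solvability clauses below.
\<close>

definition well_posed :: "triopoly \<Rightarrow> bool" where
  "well_posed M \<longleftrightarrow>
     (\<forall>x\<in>X\<^sub>1 M. \<forall>y\<in>X\<^sub>2 M. \<forall>z\<in>X\<^sub>3 M. (\<lambda>t. \<Pi>\<^sub>3 M x y t) differentiable (at z within X\<^sub>3 M)) \<and>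
     (\<forall>x\<in>X\<^sub>1 M. \<forall>y\<in>X\<^sub>2 M. \<exists>!z. z \<in> X\<^sub>3 M \<and> F\<^sub>3 M x y z = z) \<and>
     (\<forall>x\<in>X\<^sub>1 M. \<forall>y\<in>X\<^sub>2 M. (\<lambda>t. \<Phi>\<^sub>2 M x t) differentiable (at y within X\<^sub>2 M)) \<and>
     (\<forall>x\<in>X\<^sub>1 M. \<exists>!y. y \<in> X\<^sub>2 M \<and> F\<^sub>2 M x y (b\<^sub>3 M x y) = y) \<and>
     (\<forall>x\<in>X\<^sub>1 M. \<Phi>\<^sub>1 M differentiable (at x within X\<^sub>1 M)) \<and>
     (\<forall>x\<in>X\<^sub>1 M. \<forall>y\<in>X\<^sub>2 M. \<forall>z\<in>X\<^sub>3 M. F\<^sub>1 M x y z \<in> X\<^sub>1 M)"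

definition \<G>\<^sub>1 :: "triopoly \<Rightarrow> real \<times> real \<times> real \<Rightarrow> real \<times> real \<times> real" where
  "\<G>\<^sub>1 M = (\<lambda>(x, y, z).
     (F\<^sub>1 M x (b\<^sub>2 M x) (b\<^sub>3 M x (b\<^sub>2 M x)), b\<^sub>2 M x, b\<^sub>3 M x (b\<^sub>2 M x)))"

definition \<T>\<^sub>1 :: "triopoly \<Rightarrow> real \<times> real \<times> real \<Rightarrow> real \<times> real \<times> real" where
  "\<T>\<^sub>1 M = (\<lambda>(x, y, z).
     (F\<^sub>1 M x (b\<^sub>2 M x) (b\<^sub>3 M x (b\<^sub>2 M x)), F\<^sub>2 M x y (b\<^sub>3 M x y), F\<^sub>3 M x y z))"

definition M\<^sub>1 :: "real \<times> real \<times> real \<Rightarrow> real \<times> real \<times> real \<Rightarrow> real" where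
  "M\<^sub>1 = (\<lambda>(x, y, z) (u, v, w). \<bar>x - u\<bar> + \<bar>y - v\<bar> + \<bar>z - w\<bar>)"

definition stationary_triple :: "triopoly \<Rightarrow> real \<Rightarrow> real \<Rightarrow> real \<Rightarrow> bool" where
  "stationary_triple M x y z \<longleftrightarrow>
     x \<in> X\<^sub>1 M \<and> y \<in> X\<^sub>2 M \<and> z \<in> X\<^sub>3 M \<and>
     deriv_on (X\<^sub>1 M) (\<Phi>\<^sub>1 M) x = 0 \<and>
     deriv_on (X\<^sub>2 M) (\<lambda>t. \<Phi>\<^sub>2 M x t) y = 0 \<and>
     deriv_on (X\<^sub>3 M) (\<lambda>t. \<Pi>\<^sub>3 M x y t) z = 0 \<and>
     y = b\<^sub>2 M x \<and> z = b\<^sub>3 M x y"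

definition second_order_sufficient :: "triopoly \<Rightarrow> real \<Rightarrow> real \<Rightarrow> real \<Rightarrow> bool" where
  "second_order_sufficient M x y z \<longleftrightarrow>
     deriv_on (X\<^sub>3 M) (\<lambda>t. \<Pi>\<^sub>3 M x y t) z = 0 \<and>
     deriv_on (X\<^sub>2 M) (\<lambda>t. \<Phi>\<^sub>2 M x t) y = 0 \<and>
     deriv_on (X\<^sub>1 M) (\<Phi>\<^sub>1 M) x = 0 \<and>
     deriv_on (X\<^sub>3 M) (deriv_on (X\<^sub>3 M) (\<lambda>t. \<Pi>\<^sub>3 M x y t)) z < 0 \<and>
     deriv_on (X\<^sub>2 M) (deriv_on (X\<^sub>2 M) (\<lambda>t. \<Phi>\<^sub>2 M x t)) y < 0 \<and>
     deriv_on (X\<^sub>1 M) (deriv_on (X\<^sub>1 M) (\<Phi>\<^sub>1 M)) x < 0"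

text \<open>
  Twice continuous (Frechet) differentiability on some open neighbourhood of \<open>p\<close>.
\<close>

definition C2_near :: "('a::real_normed_vector \<Rightarrow> real) \<Rightarrow> 'a \<Rightarrow> bool" where
  "C2_near f p \<longleftrightarrow>
     (\<exists>U (f' :: 'a \<Rightarrow> 'a \<Rightarrow>\<^sub>L real) (f'' :: 'a \<Rightarrow> 'a \<Rightarrow>\<^sub>L 'a \<Rightarrow>\<^sub>L real).
        open U \<and> p \<in> U \<and>
        (\<forall>q\<in>U. (f has_derivative blinfun_apply (f' q)) (at q)) \<and>
        (\<forall>q\<in>U. (f' has_derivative blinfun_apply (f'' q)) (at q)) \<and>
        continuous_on U f'')"

text \<open>
  Smoothness of \<open>\<Pi>\<^sub>3\<close>, \<open>\<Phi>\<^sub>2\<close>, \<open>\<Phi>\<^sub>1\<close> and of all functions they are built from, each near the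
  point at which it is evaluated for the triple \<open>(x, y, z)\<close>.
\<close>

definition C2_data_near :: "triopoly \<Rightarrow> real \<Rightarrow> real \<Rightarrow> real \<Rightarrow> bool" where
  "C2_data_near M x y z \<longleftrightarrow>
     C2_near (\<lambda>(x, y, z). \<Pi>\<^sub>1 M x y z) (x, y, z) \<and>
     C2_near (\<lambda>(x, y, z). \<Pi>\<^sub>2 M x y z) (x, y, z) \<and>
     C2_near (\<lambda>(x, y, z). \<Pi>\<^sub>3 M x y z) (x, y, z) \<and>
     C2_near (\<lambda>(x, y). \<Phi>\<^sub>2 M x y) (x, y) \<and>
     C2_near (\<Phi>\<^sub>1 M) x \<and>
     C2_near (\<lambda>(x, y). b\<^sub>3 M x y) (x, y) \<and>
     C2_near (b\<^sub>2 M) x \<and>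
     C2_near (demand M) (x + y + z) \<and>
     C2_near (c\<^sub>1 M) x \<and> C2_near (c\<^sub>2 M) y \<and> C2_near (c\<^sub>3 M) z"

end

theory Submission imports Defs begin

text \<open>
  Each component of the map \<open>\<T>\<^sub>1\<close> is a coordinate plus the derivative of that firm's reduced
  payoff: \<open>t + \<phi>' t\<close>. If two points of \<open>D\<close> differ in a single coordinate, their \<open>M\<^sub>1\<close>-distance is
  the difference of that coordinate, and the \<open>M\<^sub>1\<close>-distance of the images is at least the
  difference of the corresponding component of \<open>\<T>\<^sub>1\<close>. So the contraction hypothesis
  makes \<open>t + \<phi>' t\<close> a \<open>\<beta>\<close>-contraction in that coordinate near the stationary triple, and
  differentiating gives \<open>\<bar>1 + \<phi>''\<bar> \<le> \<beta> < 1\<close>, whence \<open>\<phi>'' < 0\<close>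
  (\<open>iterated_deriv_on_neg_if_slice_contraction\<close>). Moving one coordinate may change the
  other components of \<open>\<T>\<^sub>1\<close> as well, but they contribute nonnegative terms to \<open>M\<^sub>1\<close>, so no cross
  derivative enters.

  The analytic part is that the second derivative exists: the smoothness hypothesis concerns
  functions of several variables, and it has to be carried over to their restrictions to lines and
  to derivatives taken within a set. At an interior point the latter are ordinary derivatives
  (\<open>C2_near_imp_deriv_on_slice_differentiable\<close>).
\<close>

lemma eventually_mem_nhds_imp_interior:
  assumes "\<forall>\<^sub>F t in nhds a. t \<in> X"
  shows "a \<in> interior X"
  using assms by (auto simp: eventually_nhds interior_def)

lemma deriv_on_eq_interior:
  assumes "(f has_real_derivative d) (at t)" "t \<in> interior X"
  shows "deriv_on X f t = d"
  unfolding deriv_on_def at_within_interior[OF assms(2)]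
  using assms(1)
  by (intro vector_derivative_at) (simp only: has_real_derivative_iff_has_vector_derivative)

text \<open>
  The chain rule along the line \<open>t \<mapsto> a + t v\<close> gives the first derivative \<open>f' (a + t v) v\<close> for
  all \<open>t\<close> near \<open>t\<^sub>0\<close>. This expression is again differentiable, and differentiability at \<open>t\<^sub>0\<close>
  depends only on the values near \<open>t\<^sub>0\<close>.
\<close>

lemma C2_near_imp_deriv_on_slice_differentiable:
  fixes f :: "'a::real_normed_vector \<Rightarrow> real"
  assumes "C2_near f (a + t\<^sub>0 *\<^sub>R v)" and t0: "t\<^sub>0 \<in> interior X"
  shows "\<exists>m. (deriv_on X (\<lambda>t. f (a + t *\<^sub>R v)) has_real_derivative m) (at t\<^sub>0)"
proof -
  obtain U and f' :: "'a \<Rightarrow> 'a \<Rightarrow>\<^sub>L real" and f'' :: "'a \<Rightarrow> 'a \<Rightarrow>\<^sub>L 'a \<Rightarrow>\<^sub>L real"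
    where U: "open U" "a + t\<^sub>0 *\<^sub>R v \<in> U"
      and f': "\<And>q. q \<in> U \<Longrightarrow> (f has_derivative blinfun_apply (f' q)) (at q)"
      and f'': "\<And>q. q \<in> U \<Longrightarrow> (f' has_derivative blinfun_apply (f'' q)) (at q)"
    using assms(1) unfolding C2_near_def by blast
  define \<gamma> where "\<gamma> t = a + t *\<^sub>R v" for t :: real
  have \<gamma>: "(\<gamma> has_derivative (\<lambda>h. h *\<^sub>R v)) (at t)" for t
    unfolding \<gamma>_def by (auto intro!: derivative_eq_intros)
  define S where "S = \<gamma> -` U \<inter> interior X"
  have "open (\<gamma> -` U)"
    using U(1) unfolding \<gamma>_def by (intro open_vimage continuous_intros)
  then have S: "open S" "t\<^sub>0 \<in> S"
    using U(2) t0 by (auto simp: S_def \<gamma>_def)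
  have first: "deriv_on X (\<lambda>t. f (\<gamma> t)) t = f' (\<gamma> t) v" if "t \<in> S" for t
  proof (rule deriv_on_eq_interior)
    have "((\<lambda>t. f (\<gamma> t)) has_derivative (\<lambda>h. f' (\<gamma> t) (h *\<^sub>R v))) (at t)"
      using that by (intro has_derivative_compose[OF \<gamma> f']) (simp add: S_def)
    then show "((\<lambda>t. f (\<gamma> t)) has_real_derivative f' (\<gamma> t) v) (at t)"
      by (rule has_derivative_imp_has_field_derivative) (simp add: blinfun.scaleR_right)
  qed (use that in \<open>simp add: S_def\<close>)
  have "((\<lambda>t. f' (\<gamma> t)) has_derivative (\<lambda>h. f'' (\<gamma> t\<^sub>0) (h *\<^sub>R v))) (at t\<^sub>0)"
    using S(2) by (intro has_derivative_compose[OF \<gamma> f'']) (simp add: S_def)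
  then have "((\<lambda>t. f' (\<gamma> t) v) has_derivative (\<lambda>h. f'' (\<gamma> t\<^sub>0) (h *\<^sub>R v) v)) (at t\<^sub>0)"
    by (rule bounded_linear.has_derivative[OF blinfun.bounded_linear_left])
  then have "((\<lambda>t. f' (\<gamma> t) v) has_real_derivative f'' (\<gamma> t\<^sub>0) v v) (at t\<^sub>0)"
    by (rule has_derivative_imp_has_field_derivative)
      (simp add: blinfun.scaleR_right blinfun.scaleR_left)
  then have "(deriv_on X (\<lambda>t. f (\<gamma> t)) has_real_derivative f'' (\<gamma> t\<^sub>0) v v) (at t\<^sub>0)"
    by (rule has_field_derivative_transform_within_open[OF _ S]) (simp add: first)
  then show ?thesis
    unfolding \<gamma>_def by blast
qed

text \<open>Difference quotients of a \<open>\<beta>\<close>-contraction are bounded by \<open>\<beta>\<close>, hence so is their limit.\<close>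

lemma abs_deriv_le_if_local_contraction:
  fixes F :: "real \<Rightarrow> real"
  assumes F: "(F has_real_derivative m) (at a)"
    and contr: "\<forall>\<^sub>F t in at a. \<bar>F t - F a\<bar> \<le> \<beta> * \<bar>t - a\<bar>"
  shows "\<bar>m\<bar> \<le> \<beta>"
proof -
  have "((\<lambda>t. \<bar>(F t - F a) / (t - a)\<bar>) \<longlongrightarrow> \<bar>m\<bar>) (at a)"
    using F by (intro tendsto_rabs) (simp add: has_field_derivative_iff)
  moreover have "\<forall>\<^sub>F t in at a. \<bar>(F t - F a) / (t - a)\<bar> \<le> \<beta>"
    using contr eventually_neq_at_within[of a a UNIV]
    by eventually_elim (simp add: divide_le_eq)
  ultimately show ?thesis
    by (rule tendsto_upperbound) simp
qed

lemma iterated_deriv_on_neg_if_slice_contraction: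
  fixes f :: "'a::real_normed_vector \<Rightarrow> real" and a v :: 'a
  defines "g \<equiv> \<lambda>t. f (a + t *\<^sub>R v)"
  assumes C2: "C2_near f (a + t\<^sub>0 *\<^sub>R v)"
    and X: "\<forall>\<^sub>F t in nhds t\<^sub>0. t \<in> X"
    and "\<beta> < 1"
    and contr: "\<forall>\<^sub>F t in nhds t\<^sub>0.
      \<bar>(t + deriv_on X g t) - (t\<^sub>0 + deriv_on X g t\<^sub>0)\<bar> \<le> \<beta> * \<bar>t - t\<^sub>0\<bar>"
  shows "deriv_on X (deriv_on X g) t\<^sub>0 < 0"
proof -
  have t0: "t\<^sub>0 \<in> interior X"
    using X by (rule eventually_mem_nhds_imp_interior)
  obtain m where m: "(deriv_on X g has_real_derivative m) (at t\<^sub>0)"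
    using C2_near_imp_deriv_on_slice_differentiable[OF C2 t0] unfolding g_def by blast
  have "((\<lambda>t. t + deriv_on X g t) has_real_derivative 1 + m) (at t\<^sub>0)"
    using m by (intro derivative_intros)
  then have "\<bar>1 + m\<bar> \<le> \<beta>"
    by (rule abs_deriv_le_if_local_contraction)
      (use contr in \<open>simp add: eventually_nhds_conv_at\<close>)
  with \<open>\<beta> < 1\<close> have "m < 0" by linarith
  with deriv_on_eq_interior[OF m t0] show ?thesis by simp
qed

lemma eventually_nhds_slice_mem:
  assumes "\<gamma> t\<^sub>0 \<in> interior D" "continuous_on UNIV \<gamma>"
  shows "\<forall>\<^sub>F t in nhds t\<^sub>0. \<gamma> t \<in> D"
proof -
  have "open (\<gamma> -` interior D)"
    using assms(2) by (intro open_vimage) auto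
  then show ?thesis
    using assms(1) interior_subset unfolding eventually_nhds by blast
qed

theorem proposition5:
  fixes M :: triopoly and D :: "(real \<times> real \<times> real) set"
    and \<alpha> \<beta> xs ys zs :: real
  assumes game: "well_posed M"
    and X1: "closed (X\<^sub>1 M)" "X\<^sub>1 M \<noteq> {}"
    and X2: "closed (X\<^sub>2 M)" "X\<^sub>2 M \<noteq> {}"
    and X3: "closed (X\<^sub>3 M)" "X\<^sub>3 M \<noteq> {}"
    and D: "D \<subseteq> X\<^sub>1 M \<times> X\<^sub>2 M \<times> X\<^sub>3 M" "closed D" "D \<noteq> {}"
    and G_inv: "\<G>\<^sub>1 M ` D \<subseteq> D"
    and alpha: "0 < \<alpha>" "\<alpha> < 1"
    and G_contr: "\<forall>p\<in>D. \<forall>q\<in>D. M\<^sub>1 (\<G>\<^sub>1 M p) (\<G>\<^sub>1 M q) \<le> \<alpha> * M\<^sub>1 p q"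
    and stat: "(xs, ys, zs) \<in> D" "stationary_triple M xs ys zs"
    and inter: "(xs, ys, zs) \<in> interior D"
    and smooth: "C2_data_near M xs ys zs"
    and T_inv: "\<T>\<^sub>1 M ` D \<subseteq> D"
    and beta: "0 < \<beta>" "\<beta> < 1"
    and T_contr: "\<forall>p\<in>D. \<forall>q\<in>D. M\<^sub>1 (\<T>\<^sub>1 M p) (\<T>\<^sub>1 M q) \<le> \<beta> * M\<^sub>1 p q"
  shows "deriv_on (X\<^sub>3 M) (deriv_on (X\<^sub>3 M) (\<lambda>z. \<Pi>\<^sub>3 M xs ys z)) zs < 0 \<and>
         deriv_on (X\<^sub>2 M) (deriv_on (X\<^sub>2 M) (\<lambda>y. \<Phi>\<^sub>2 M xs y)) ys < 0 \<and>
         deriv_on (X\<^sub>1 M) (deriv_on (X\<^sub>1 M) (\<Phi>\<^sub>1 M)) xs < 0 \<and>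
         second_order_sufficient M xs ys zs"
proof -
  have in3: "\<forall>\<^sub>F t in nhds zs. (xs, ys, t) \<in> D"
    by (rule eventually_nhds_slice_mem) (use inter in \<open>auto intro!: continuous_intros\<close>)
  have in2: "\<forall>\<^sub>F t in nhds ys. (xs, t, zs) \<in> D"
    by (rule eventually_nhds_slice_mem) (use inter in \<open>auto intro!: continuous_intros\<close>)
  have in1: "\<forall>\<^sub>F t in nhds xs. (t, ys, zs) \<in> D"
    by (rule eventually_nhds_slice_mem) (use inter in \<open>auto intro!: continuous_intros\<close>)
  have contr: "M\<^sub>1 (\<T>\<^sub>1 M p) (\<T>\<^sub>1 M (xs, ys, zs)) \<le> \<beta> * M\<^sub>1 p (xs, ys, zs)" if "p \<in> D" for p
    using T_contr stat(1) that by blast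

  have C3: "C2_near (\<lambda>(x, y, z). \<Pi>\<^sub>3 M x y z) (xs, ys, zs)"
    and C2: "C2_near (\<lambda>(x, y). \<Phi>\<^sub>2 M x y) (xs, ys)"
    and C1: "C2_near (\<Phi>\<^sub>1 M) xs"
    using smooth by (auto simp: C2_data_near_def)

  \<comment> \<open>The three lines below run along the coordinate axes; the base point has \<open>0\<close> in the varied
    coordinate, so that the line parameter is that coordinate itself.\<close>
  have neg3: "deriv_on (X\<^sub>3 M) (deriv_on (X\<^sub>3 M) (\<lambda>z. \<Pi>\<^sub>3 M xs ys z)) zs < 0"
  proof -
    have "\<forall>\<^sub>F t in nhds zs. t \<in> X\<^sub>3 M"
      using in3 by eventually_elim (use D(1) in auto)
    moreover have "\<forall>\<^sub>F t in nhds zs. \<bar>F\<^sub>3 M xs ys t - F\<^sub>3 M xs ys zs\<bar> \<le> \<beta> * \<bar>t - zs\<bar>"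
      using in3 by eventually_elim (drule contr, simp add: M\<^sub>1_def \<T>\<^sub>1_def)
    ultimately show ?thesis
      using iterated_deriv_on_neg_if_slice_contraction
        [of "\<lambda>(x, y, z). \<Pi>\<^sub>3 M x y z" "(xs, ys, 0)" zs "(0, 0, 1)" "X\<^sub>3 M" \<beta>] C3 beta(2)
      by (simp add: F\<^sub>3_def)
  qed

  have neg2: "deriv_on (X\<^sub>2 M) (deriv_on (X\<^sub>2 M) (\<lambda>y. \<Phi>\<^sub>2 M xs y)) ys < 0"
  proof -
    have "\<forall>\<^sub>F t in nhds ys. t \<in> X\<^sub>2 M"
      using in2 by eventually_elim (use D(1) in auto)
    moreover have "\<forall>\<^sub>F t in nhds ys.
        \<bar>F\<^sub>2 M xs t (b\<^sub>3 M xs t) - F\<^sub>2 M xs ys (b\<^sub>3 M xs ys)\<bar> \<le> \<beta> * \<bar>t - ys\<bar>"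
      using in2 by eventually_elim (drule contr, simp add: M\<^sub>1_def \<T>\<^sub>1_def)
    ultimately show ?thesis
      using iterated_deriv_on_neg_if_slice_contraction
        [of "\<lambda>(x, y). \<Phi>\<^sub>2 M x y" "(xs, 0)" ys "(0, 1)" "X\<^sub>2 M" \<beta>] C2 beta(2)
      by (simp add: F\<^sub>2_def)
  qed

  have neg1: "deriv_on (X\<^sub>1 M) (deriv_on (X\<^sub>1 M) (\<Phi>\<^sub>1 M)) xs < 0"
  proof -
    have "\<forall>\<^sub>F t in nhds xs. t \<in> X\<^sub>1 M"
      using in1 by eventually_elim (use D(1) in auto)
    moreover have "\<forall>\<^sub>F t in nhds xs.
        \<bar>F\<^sub>1 M t (b\<^sub>2 M t) (b\<^sub>3 M t (b\<^sub>2 M t)) - F\<^sub>1 M xs (b\<^sub>2 M xs) (b\<^sub>3 M xs (b\<^sub>2 M xs))\<bar>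
          \<le> \<beta> * \<bar>t - xs\<bar>"
      using in1 by eventually_elim (drule contr, simp add: M\<^sub>1_def \<T>\<^sub>1_def)
    ultimately show ?thesis
      using iterated_deriv_on_neg_if_slice_contraction
        [of "\<Phi>\<^sub>1 M" 0 xs 1 "X\<^sub>1 M" \<beta>] C1 beta(2)
      by (simp add: F\<^sub>1_def)
  qed

  show ?thesis
    using neg1 neg2 neg3 stat(2)
    unfolding second_order_sufficient_def stationary_triple_def by blast
qed

end
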